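(* Let $F \subset \mathbb{R}^d$ be a non-empty compact set and let $s=\dim_{\mathrm{H}}(F)$ be its Hausdorff dimension. Suppose that there is a constant $D \ge 1$ such that for each $x \in F$ and each $0<r\le \operatorname{diam}(F)$ there exists a mapping $g \colon F \to F \cap B(x,r)$ for which $$D^{-1}r|y-z| \le |g(y)-g(z)| \le Dr|y-z|$$ for all $y,z \in F$. Then there exists a constant $C \ge 1$ such that $$\mathcal{H}^s(F \cap B(x,r)) \le Cr^s$$ for all $x \in \mathbb{R}^d$ and $r>0$, and $$\mathcal{H}^s(F\cap A) \le C\,\mathcal{H}^s_\infty(F \cap A)$$ for all $A \subset \mathbb{R}^d$.
   Context: $B(x,r)$ denotes the closed ball in $\mathbb{R}^d$ with centre $x$ and radius $r$. For $A \subset \mathbb{R}^d$ and $0<\delta\le\infty$, the $s$-dimensional Hausdorff $\delta$-content is $\mathcal{H}^s_\delta(A) = \inf\{ \sum_i \operatorname{diam}(U_i)^s : A \subset \bigcup_i U_i \text{ and } \operatorname{diam}(U_i) \le \delta \}$ (countable covers), and the $s$-dimensional Hausdorff (outer) measure is $\mathcal{H}^s(A) = \lim_{\delta \downarrow 0} \mathcal{H}^s_\delta(A) = \sup_{\delta>0}\mathcal{H}^s_\delta(A)$. The Hausdorff dimension is $\dim_{\mathrm{H}}(A) = \inf\{s : \mathcal{H}^s(A)=0\}$. *)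

theory Defs
  imports "HOL-Analysis.Analysis"
begin

(* The library's diameter is real-valued and carries no information for unbounded sets;
   here these have diameter infinity. *)
definition ediameter :: "'a::metric_space set \<Rightarrow> ennreal" where
  "ediameter U = (if bounded U then ennreal (diameter U) else \<infinity>)"

(* diam(U)^s for s >= 0, with the conventions of geometric measure theory: the empty set
   contributes 0 for every s, and diam(U)^0 = 1 for every nonempty U, including singletons
   (so that the 0-dimensional Hausdorff measure is counting measure).  The case split is
   needed because 0 powr 0 = 0 in HOL. *)
definition diam_power :: "real \<Rightarrow> 'a::metric_space set \<Rightarrow> ennreal" where
  "diam_power s U =
     (if U = {} then 0
      else if s = 0 then 1
      else if bounded U then ennreal (diameter U powr s)
      else \<infinity>)"

(* Countable covers are sequences of sets; finite covers are padded with empty sets,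
   which cost nothing. *)
definition hausdorff_content :: "real \<Rightarrow> ennreal \<Rightarrow> 'a::metric_space set \<Rightarrow> ennreal" where
  "hausdorff_content s \<delta> A =
     Inf {(\<Sum>i. diam_power s (U i)) | U :: nat \<Rightarrow> 'a set.
            A \<subseteq> (\<Union>i. U i) \<and> (\<forall>i. ediameter (U i) \<le> \<delta>)}"

definition hausdorff_measure :: "real \<Rightarrow> 'a::metric_space set \<Rightarrow> ennreal" where
  "hausdorff_measure s A = (SUP \<delta>\<in>{0<..}. hausdorff_content s \<delta> A)"

(* Restricted to Euclidean spaces, where the set below contains every s greater than the
   dimension of the space, so that the real infimum is meaningful. *)
definition hausdorff_dim :: "'a::euclidean_space set \<Rightarrow> real" where
  "hausdorff_dim A = Inf {s. 0 \<le> s \<and> hausdorff_measure s A = 0}"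

end

theory Submission
  imports Defs
begin

text \<open>
  Finiteness of the measure: if a \<open>3r\<close>-separated set \<open>X \<subseteq> F\<close> had more than \<open>(D/r)\<^sup>s\<close> points, the
  copies of \<open>F\<close> in the balls of radius \<open>r\<close> around \<open>X\<close> would form a separated iterated function
  system whose contraction ratios are at least \<open>r/D\<close>, hence a subset of \<open>F\<close> of dimension larger
  than \<open>s\<close>. So \<open>F\<close> is covered by at most \<open>(D/r)\<^sup>s\<close> balls of radius \<open>3r\<close>.

  Upper regularity: suppose \<open>U = F \<inter> B(x,r)\<close> has measure much larger than \<open>r\<^sup>s\<close>, and place a copy of
  \<open>U\<close> of size about \<open>Rr\<close> in each ball of a maximal packing of \<open>F\<close> at a small scale \<open>R\<close>. The copies
  carry a proportion of the measure of \<open>F\<close> that does not depend on \<open>R\<close>, but each of them can be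
  covered by a single set at a much smaller cost. Hence the contents of \<open>F\<close> at the scales \<open>Rr\<close> stay
  a fixed amount below the measure of \<open>F\<close>, which contradicts the definition of the latter as
  \<open>R \<rightarrow> 0\<close>. Comparing measure and content is then a matter of enclosing every set of a cover in a
  ball of radius equal to its diameter.
\<close>

section \<open>Hausdorff content and measure\<close>

lemma suminf_ennreal_half_powers: "e > 0 \<Longrightarrow> (\<Sum>n. ennreal (e * (1/2) ^ Suc n)) = ennreal e"
  using sums_mult[OF power_half_series, of e] by (intro suminf_ennreal_eq) auto

section \<open>Diameters and their powers\<close>

text \<open>For finite \<open>d\<close> the pairwise bound already forces boundedness. This removes
  the case split in \<open>ediameter\<close> and also covers the empty set and
  \<open>d = \<infinity>\<close>.\<close>

lemma ediameter_le_iff: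
  "ediameter U \<le> d \<longleftrightarrow> (\<forall>x\<in>U. \<forall>y\<in>U. ennreal (dist x y) \<le> d)"
proof
  assume "ediameter U \<le> d"
  then show "\<forall>x\<in>U. \<forall>y\<in>U. ennreal (dist x y) \<le> d"
    by (auto simp: ediameter_def top_unique split: if_splits
        intro: order_trans[OF ennreal_leI[OF diameter_bounded_bound]])
next
  assume R: "\<forall>x\<in>U. \<forall>y\<in>U. ennreal (dist x y) \<le> d"
  show "ediameter U \<le> d"
  proof (cases d rule: ennreal_cases)
    case (real b)
    then have b: "dist x y \<le> b" if "x \<in> U" "y \<in> U" for x y
      using R that by (auto simp: ennreal_le_iff)
    then have "bounded U"
      by (metis bounded_two_points)
    moreover have "diameter U \<le> b"
      unfolding diameter_def using b real(1) by (auto intro!: cSUP_least)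
    ultimately show ?thesis
      using real by (simp add: ediameter_def ennreal_leI)
  qed simp
qed

lemma diam_power_empty [simp]: "diam_power s {} = 0"
  by (simp add: diam_power_def)

text \<open>Positivity of \<open>b\<close> matters at \<open>s = 0\<close>, where a nonempty set
  counts \<open>1\<close> but \<open>0 powr 0 = 0\<close>.\<close>

lemma diam_power_le_powr:
  assumes "s \<ge> 0" "b > 0" "\<And>x y. x \<in> U \<Longrightarrow> y \<in> U \<Longrightarrow> dist x y \<le> b"
  shows "diam_power s U \<le> ennreal (b powr s)"
proof -
  have "ediameter U \<le> ennreal b"
    using assms by (auto simp: ediameter_le_iff intro: ennreal_leI)
  then have "bounded U" "diameter U \<le> b"
    using \<open>b > 0\<close> by (auto simp: ediameter_def top_unique split: if_splits)
  then show ?thesis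
    using assms by (auto simp: diam_power_def diameter_ge_0 intro!: ennreal_leI powr_mono2)
qed

lemma powr_dist_le_diam_power:
  assumes "s \<ge> 0" "b > 0" "x \<in> U" "y \<in> U" "b \<le> dist x y"
  shows "ennreal (b powr s) \<le> diam_power s U"
proof -
  have "b \<le> diameter U" if "bounded U"
    using diameter_bounded_bound[OF that assms(3,4)] assms(5) by simp
  then show ?thesis
    using assms by (auto simp: diam_power_def intro!: ennreal_leI powr_mono2)
qed

text \<open>The tool for pulling covers back: \<open>V\<close> is the part of the domain that
  \<open>f\<close> sends into a covering set \<open>U\<close>.\<close>

lemma diam_power_expanding_le:
  assumes "s \<ge> 0" "c > 0" "f ` V \<subseteq> U"
    and f: "\<And>x y. x \<in> V \<Longrightarrow> y \<in> V \<Longrightarrow> c * dist x y \<le> dist (f x) (f y)"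
  shows "ennreal (c powr s) * diam_power s V \<le> diam_power s U"
proof (cases "V = {} \<or> s = 0 \<or> \<not> bounded U")
  case True
  then show ?thesis
    using assms by (auto simp: diam_power_def)
next
  case False
  then have "bounded U" "V \<noteq> {}" by auto
  have le: "dist x y \<le> diameter U / c" if "x \<in> V" "y \<in> V" for x y
  proof -
    have "c * dist x y \<le> diameter U"
      using f[OF that] diameter_bounded_bound[OF \<open>bounded U\<close>, of "f x" "f y"] that assms(3)
      by (auto simp: image_subset_iff)
    then show ?thesis using \<open>c > 0\<close> by (simp add: field_simps)
  qed
  then have "bounded V" by (metis bounded_two_points)
  have "diameter V \<le> diameter U / c"
    unfolding diameter_def[of V] using le \<open>V \<noteq> {}\<close> by (auto intro!: cSUP_least)
  then have "(c * diameter V) powr s \<le> diameter U powr s"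
    using assms \<open>bounded V\<close> by (intro powr_mono2) (auto simp: diameter_ge_0 field_simps)
  then show ?thesis
    using False \<open>bounded V\<close> assms
    by (auto simp: diam_power_def ennreal_leI powr_mult diameter_ge_0 simp flip: ennreal_mult)
qed

text \<open>The open \<open>e\<close>-neighbourhood of \<open>U\<close> has diameter at most
  \<open>d + 2 * e\<close>, and \<open>powr t\<close> is right-continuous at \<open>d\<close>. This
  prepares covers for compactness.\<close>

lemma diam_power_enlarge_open:
  assumes "t > 0" "\<epsilon> > 0"
  obtains V where "open V" "U \<subseteq> V" "diam_power t V \<le> diam_power t U + ennreal \<epsilon>"
proof (cases "U = {} \<or> \<not> bounded U")
  case True
  then show ?thesis
    using that[of "if U = {} then {} else UNIV"] assms by (auto simp: diam_power_def)
next
  case False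
  define d where "d = diameter U"
  have d: "d \<ge> 0" using False by (simp add: d_def diameter_ge_0)
  \<comment> \<open>A singleton has \<open>d = 0\<close>; continuity at \<open>0\<close> rests on
    \<open>t > 0\<close>.\<close>
  have "((\<lambda>e. (d + 2 * e) powr t) \<longlongrightarrow> (d + 2 * 0) powr t) (at_right 0)"
    using d assms by (intro tendsto_powr' tendsto_intros) (auto simp: eventually_at_right_less
        intro!: eventually_mono[OF eventually_at_right_less])
  then have "eventually (\<lambda>e. (d + 2 * e) powr t < d powr t + \<epsilon>) (at_right 0)"
    using assms by (intro order_tendstoD) auto
  then have "eventually (\<lambda>e. 0 < e \<and> (d + 2 * e) powr t < d powr t + \<epsilon>) (at_right 0)"
    using eventually_at_right_less[of "0::real"] by eventually_elim simp
  then obtain e where e: "e > 0" "(d + 2 * e) powr t < d powr t + \<epsilon>"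
    by (metis (no_types, lifting) eventually_happens trivial_limit_at_right_real)
  define V where "V = (\<Union>x\<in>U. ball x e)"
  have "dist y z \<le> d + 2 * e" if yz: "y \<in> V" "z \<in> V" for y z
  proof -
    obtain x x' where "x \<in> U" "x' \<in> U" "dist x y < e" "dist x' z < e"
      using yz unfolding V_def UN_iff mem_ball by blast
    moreover have "dist x x' \<le> d"
      using calculation False by (simp add: d_def diameter_bounded_bound)
    ultimately show ?thesis
      using dist_triangle[of y z x] dist_triangle[of x z x'] by (simp add: dist_commute)
  qed
  then have "diam_power t V \<le> ennreal ((d + 2 * e) powr t)"
    using assms e d by (intro diam_power_le_powr) auto
  also have "\<dots> \<le> ennreal (d powr t) + ennreal \<epsilon>"
    using e assms by (simp flip: ennreal_plus add: ennreal_leI)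
  also have "ennreal (d powr t) = diam_power t U"
    using False assms by (simp add: diam_power_def d_def)
  finally show ?thesis
    using e by (intro that[of V]) (auto simp: V_def)
qed

section \<open>Content: countable subadditivity and finite covers\<close>

lemma hausdorff_content_le_suminf:
  assumes "A \<subseteq> (\<Union>i. U i)" "\<And>i. ediameter (U i) \<le> \<delta>"
  shows "hausdorff_content s \<delta> A \<le> (\<Sum>i. diam_power s (U i))"
  unfolding hausdorff_content_def using assms by (intro Inf_lower) auto

lemma hausdorff_content_greatest:
  assumes "\<And>U :: nat \<Rightarrow> _. A \<subseteq> (\<Union>i. U i) \<Longrightarrow> (\<And>i. ediameter (U i) \<le> \<delta>)
             \<Longrightarrow> c \<le> (\<Sum>i. diam_power s (U i))"
  shows "c \<le> hausdorff_content s \<delta> A"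
  unfolding hausdorff_content_def using assms by (intro Inf_greatest) auto

lemma hausdorff_content_near_optimal:
  assumes "hausdorff_content s \<delta> A < \<infinity>" "e > 0"
  obtains U :: "nat \<Rightarrow> _" where "A \<subseteq> (\<Union>i. U i)" "\<And>i. ediameter (U i) \<le> \<delta>"
    "(\<Sum>i. diam_power s (U i)) \<le> hausdorff_content s \<delta> A + ennreal e"
proof -
  have "hausdorff_content s \<delta> A < hausdorff_content s \<delta> A + ennreal e"
    using assms by (cases "hausdorff_content s \<delta> A" rule: ennreal_cases)
      (auto simp: ennreal_less_iff simp flip: ennreal_plus)
  then obtain v where "v < hausdorff_content s \<delta> A + ennreal e"
    and "v \<in> {(\<Sum>i. diam_power s (U i)) | U :: nat \<Rightarrow> 'a set.
            A \<subseteq> (\<Union>i. U i) \<and> (\<forall>i. ediameter (U i) \<le> \<delta>)}"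
    unfolding hausdorff_content_def[of s \<delta> A] Inf_less_iff by blast
  then show ?thesis
    using that by (auto dest: less_imp_le)
qed

lemma ediameter_empty_le [simp]: "ediameter {} \<le> \<delta>"
  by (simp add: ediameter_def)

lemma hausdorff_content_mono: "A \<subseteq> B \<Longrightarrow> hausdorff_content s \<delta> A \<le> hausdorff_content s \<delta> B"
  by (intro hausdorff_content_greatest hausdorff_content_le_suminf) auto

lemma hausdorff_content_antimono:
  "\<delta> \<le> \<delta>' \<Longrightarrow> hausdorff_content s \<delta>' A \<le> hausdorff_content s \<delta> A"
  by (intro hausdorff_content_greatest hausdorff_content_le_suminf) (auto intro: order_trans)

lemma hausdorff_content_empty [simp]: "hausdorff_content s \<delta> {} = 0"
  using hausdorff_content_le_suminf[of "{}" "\<lambda>_. {}" \<delta> s] by simp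

lemma hausdorff_content_le_diam_power:
  assumes "ediameter U \<le> \<delta>"
  shows "hausdorff_content s \<delta> U \<le> diam_power s U"
proof -
  have "hausdorff_content s \<delta> U \<le> (\<Sum>i. diam_power s (if i = 0 then U else {}))"
    using assms by (intro hausdorff_content_le_suminf) (auto split: if_splits)
  also have "\<dots> = (\<Sum>i\<in>{0::nat}. diam_power s (if i = 0 then U else {}))"
    by (intro suminf_finite) auto
  finally show ?thesis by simp
qed

text \<open>Covers of the \<open>A n\<close> that are optimal up to \<open>e / 2 ^ (n + 1)\<close>
  are merged into one sequence through the pairing of natural numbers.\<close>

lemma hausdorff_content_UN_le:
  fixes A :: "nat \<Rightarrow> 'a::metric_space set"
  shows "hausdorff_content s \<delta> (\<Union>n. A n) \<le> (\<Sum>n. hausdorff_content s \<delta> (A n))"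
proof (rule ennreal_le_epsilon)
  fix e :: real
  assume fin: "(\<Sum>n. hausdorff_content s \<delta> (A n)) < top" and "e > 0"
  have "hausdorff_content s \<delta> (A n) < \<infinity>" for n
    using ennreal_suminf_lessD[OF fin] by simp
  then have "\<exists>U. A n \<subseteq> (\<Union>i::nat. U i) \<and> (\<forall>i. ediameter (U i) \<le> \<delta>) \<and>
      (\<Sum>i. diam_power s (U i)) \<le> hausdorff_content s \<delta> (A n) + ennreal (e * (1/2) ^ Suc n)" for n
    using hausdorff_content_near_optimal[of s \<delta> "A n" "e * (1/2) ^ Suc n"] \<open>e > 0\<close>
    by (metis divide_pos_pos mult_pos_pos zero_less_numeral zero_less_one zero_less_power)
  then obtain U where U: "\<And>n. A n \<subseteq> (\<Union>i::nat. U n i)" "\<And>n i. ediameter (U n i) \<le> \<delta>"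
    "\<And>n. (\<Sum>i. diam_power s (U n i)) \<le> hausdorff_content s \<delta> (A n) + ennreal (e * (1/2) ^ Suc n)"
    by metis
  define W where "W = (\<lambda>(n, i). U n i)"
  have "(\<Union>n. A n) \<subseteq> (\<Union>k. W (prod_decode k))"
  proof
    fix x assume "x \<in> (\<Union>n. A n)"
    then obtain n i where "x \<in> U n i" using U(1) by blast
    then show "x \<in> (\<Union>k. W (prod_decode k))"
      by (auto simp: W_def intro!: exI[of _ "prod_encode (n, i)"])
  qed
  then have "hausdorff_content s \<delta> (\<Union>n. A n) \<le> (\<Sum>k. diam_power s (W (prod_decode k)))"
    by (intro hausdorff_content_le_suminf) (auto simp: W_def U(2) split: prod.split)
  also have "\<dots> = (\<Sum>n. \<Sum>i. diam_power s (W (n, i)))"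
    by (rule suminf_ennreal_2dimen[where f = "\<lambda>p. diam_power s (W p)"]) simp
  also have "\<dots> \<le> (\<Sum>n. hausdorff_content s \<delta> (A n) + ennreal (e * (1/2) ^ Suc n))"
    using U(3) by (intro suminf_le) (auto simp: W_def)
  also have "\<dots> = (\<Sum>n. hausdorff_content s \<delta> (A n)) + (\<Sum>n. ennreal (e * (1/2) ^ Suc n))"
    by (simp add: suminf_add)
  also have "(\<Sum>n. ennreal (e * (1/2) ^ Suc n)) = ennreal e"
    using \<open>e > 0\<close> by (rule suminf_ennreal_half_powers)
  finally show "hausdorff_content s \<delta> (\<Union>n. A n) \<le> (\<Sum>n. hausdorff_content s \<delta> (A n)) + ennreal e" .
qed

lemma hausdorff_content_Un_le:
  "hausdorff_content s \<delta> (A \<union> B) \<le> hausdorff_content s \<delta> A + hausdorff_content s \<delta> B"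
proof -
  have "hausdorff_content s \<delta> (\<Union>n. binaryset A B n) \<le> (\<Sum>n. hausdorff_content s \<delta> (binaryset A B n))"
    by (rule hausdorff_content_UN_le)
  also have "\<dots> = hausdorff_content s \<delta> A + hausdorff_content s \<delta> B"
    by (rule suminf_binaryset_eq) simp
  finally show ?thesis by (simp add: UN_binaryset_eq)
qed

lemma hausdorff_content_finite_UN_le:
  "finite I \<Longrightarrow> hausdorff_content s \<delta> (\<Union>i\<in>I. A i) \<le> (\<Sum>i\<in>I. hausdorff_content s \<delta> (A i))"
proof (induction I rule: finite_induct)
  case (insert i I)
  then show ?case
    using hausdorff_content_Un_le[of s \<delta> "A i" "\<Union>i\<in>I. A i"]
    by (simp add: order_trans[OF _ add_left_mono])
qed simp

lemma hausdorff_content_finite_cover_le: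
  assumes "s \<ge> 0" "b > 0" "finite I" "A \<subseteq> (\<Union>i\<in>I. U i)"
    and "\<And>i x y. i \<in> I \<Longrightarrow> x \<in> U i \<Longrightarrow> y \<in> U i \<Longrightarrow> dist x y \<le> b"
  shows "hausdorff_content s (ennreal b) A \<le> ennreal (real (card I) * b powr s)"
proof -
  have "hausdorff_content s (ennreal b) A \<le> (\<Sum>i\<in>I. hausdorff_content s (ennreal b) (U i))"
    using hausdorff_content_mono[OF assms(4)] hausdorff_content_finite_UN_le[OF assms(3)]
    by (rule order_trans)
  also have "\<dots> \<le> (\<Sum>i\<in>I. ennreal (b powr s))"
  proof (rule sum_mono)
    fix i assume "i \<in> I"
    have "hausdorff_content s (ennreal b) (U i) \<le> diam_power s (U i)"
      using assms \<open>i \<in> I\<close>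
      by (intro hausdorff_content_le_diam_power) (auto simp: ediameter_le_iff intro: ennreal_leI)
    also have "\<dots> \<le> ennreal (b powr s)"
      using assms \<open>i \<in> I\<close> by (intro diam_power_le_powr) auto
    finally show "hausdorff_content s (ennreal b) (U i) \<le> ennreal (b powr s)" .
  qed
  also have "\<dots> = ennreal (real (card I) * b powr s)"
    by (simp add: ennreal_mult ennreal_of_nat_eq_real_of_nat)
  finally show ?thesis .
qed

section \<open>Hausdorff measure as a supremum of contents\<close>

lemma hausdorff_content_le_measure: "\<delta> > 0 \<Longrightarrow> hausdorff_content s \<delta> A \<le> hausdorff_measure s A"
  unfolding hausdorff_measure_def by (intro SUP_upper) auto

lemma hausdorff_measure_mono: "A \<subseteq> B \<Longrightarrow> hausdorff_measure s A \<le> hausdorff_measure s B"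
  unfolding hausdorff_measure_def by (intro SUP_mono) (auto intro: hausdorff_content_mono)

lemma hausdorff_measure_empty [simp]: "hausdorff_measure s {} = 0"
  unfolding hausdorff_measure_def by (intro antisym SUP_least) auto

lemma hausdorff_measure_UN_le:
  fixes A :: "nat \<Rightarrow> 'a::metric_space set"
  shows "hausdorff_measure s (\<Union>n. A n) \<le> (\<Sum>n. hausdorff_measure s (A n))"
  unfolding hausdorff_measure_def[of s "\<Union>n. A n"]
proof (rule SUP_least)
  fix \<delta> :: ennreal assume "\<delta> \<in> {0<..}"
  then have "(\<Sum>n. hausdorff_content s \<delta> (A n)) \<le> (\<Sum>n. hausdorff_measure s (A n))"
    by (intro suminf_le) (auto intro: hausdorff_content_le_measure)
  then show "hausdorff_content s \<delta> (\<Union>n. A n) \<le> (\<Sum>n. hausdorff_measure s (A n))"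
    using hausdorff_content_UN_le order_trans by blast
qed

text \<open>Contents grow as the scale shrinks, so the supremum, which includes
  \<open>\<delta> = \<infinity>\<close>, is decided by small real scales.\<close>

lemma hausdorff_measure_le_contentI:
  assumes "r0 > 0" "\<And>b. 0 < b \<Longrightarrow> b \<le> r0 \<Longrightarrow> hausdorff_content s (ennreal b) A \<le> c"
  shows "hausdorff_measure s A \<le> c"
  unfolding hausdorff_measure_def
proof (rule SUP_least)
  fix \<delta> :: ennreal assume "\<delta> \<in> {0<..}"
  then obtain b where b: "b > 0" "ennreal b \<le> \<delta>"
    by (cases \<delta> rule: ennreal_cases) (auto intro: that[of 1])
  have "hausdorff_content s \<delta> A \<le> hausdorff_content s (ennreal (min b r0)) A"
    using b by (intro hausdorff_content_antimono) (auto intro: order_trans[OF ennreal_leI[of _ b]])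
  also have "\<dots> \<le> c" using assms b by auto
  finally show "hausdorff_content s \<delta> A \<le> c" .
qed

lemma hausdorff_measure_singleton:
  assumes "t > 0"
  shows "hausdorff_measure t {y} = 0"
proof -
  have "hausdorff_content t (ennreal b) {y} \<le> 0" for b
    using hausdorff_content_le_diam_power[of "{y}" "ennreal b" t] assms
    by (simp add: ediameter_def diam_power_def)
  then have "hausdorff_measure t {y} \<le> 0"
    by (intro hausdorff_measure_le_contentI[of 1]) simp_all
  then show ?thesis by simp
qed

section \<open>Additivity over separated sets\<close>

text \<open>A set of diameter below \<open>\<eta>\<close> cannot meet both \<open>A\<close> and
  \<open>B\<close>, so every admissible cover splits into a cover of \<open>A\<close> and one of
  \<open>B\<close>.\<close>

lemma hausdorff_content_add_separated:
  assumes "\<delta> < ennreal \<eta>" "\<And>x y. x \<in> A \<Longrightarrow> y \<in> B \<Longrightarrow> \<eta> \<le> dist x y"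
  shows "hausdorff_content s \<delta> A + hausdorff_content s \<delta> B \<le> hausdorff_content s \<delta> (A \<union> B)"
proof (rule hausdorff_content_greatest)
  fix U :: "nat \<Rightarrow> 'a set"
  assume U: "A \<union> B \<subseteq> (\<Union>i. U i)" "\<And>i. ediameter (U i) \<le> \<delta>"
  \<comment> \<open>Sets that miss \<open>C\<close> become empty rather than being removed: the
    indexing stays and the empty set costs nothing.\<close>
  define P where "P C i = (if U i \<inter> C = {} then {} else U i)" for C i
  have P: "hausdorff_content s \<delta> C \<le> (\<Sum>i. diam_power s (P C i))" if "C \<subseteq> A \<union> B" for C
  proof (rule hausdorff_content_le_suminf)
    show "C \<subseteq> (\<Union>i. P C i)"
      using U(1) that by (fastforce simp: P_def)
    show "ediameter (P C i) \<le> \<delta>" for i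
      using U(2)[of i] by (simp add: P_def)
  qed
  have "diam_power s (P A i) + diam_power s (P B i) \<le> diam_power s (U i)" for i
  proof -
    have "U i \<inter> A = {} \<or> U i \<inter> B = {}"
    proof (rule ccontr)
      assume "\<not> ?thesis"
      then obtain x y where xy: "x \<in> A" "y \<in> B" "x \<in> U i" "y \<in> U i" by blast
      then have "ennreal (dist x y) \<le> \<delta>" "\<eta> \<le> dist x y"
        using U(2)[of i] assms(2) by (auto simp: ediameter_le_iff)
      then show False
        using assms(1) by (meson ennreal_leI leD order_trans)
    qed
    then show ?thesis by (auto simp: P_def)
  qed
  then have "(\<Sum>i. diam_power s (P A i)) + (\<Sum>i. diam_power s (P B i)) \<le> (\<Sum>i. diam_power s (U i))"
    by (subst suminf_add) (auto intro!: suminf_le)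
  then show "hausdorff_content s \<delta> A + hausdorff_content s \<delta> B \<le> (\<Sum>i. diam_power s (U i))"
    using add_mono[OF P[of A] P[of B]] by auto
qed

text \<open>By monotonicity in the scale the two suprema merge into one over a common scale, which
  may be taken below \<open>\<eta>\<close>.\<close>

lemma hausdorff_measure_add_separated:
  assumes "\<eta> > 0" "\<And>x y. x \<in> A \<Longrightarrow> y \<in> B \<Longrightarrow> \<eta> \<le> dist x y"
  shows "hausdorff_measure s A + hausdorff_measure s B \<le> hausdorff_measure s (A \<union> B)"
proof -
  have "hausdorff_measure s A + hausdorff_measure s B =
      (SUP \<delta>\<in>{0<..}. hausdorff_content s \<delta> A + hausdorff_content s \<delta> B)"
    unfolding hausdorff_measure_def
  proof (rule SUP_add_directed_ennreal[symmetric])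
    fix i j :: ennreal assume "i \<in> {0<..}" "j \<in> {0<..}"
    then show "\<exists>k\<in>{0<..}. hausdorff_content s i A + hausdorff_content s j B
        \<le> hausdorff_content s k A + hausdorff_content s k B"
      by (intro bexI[of _ "min i j"] add_mono hausdorff_content_antimono) auto
  qed
  also have "\<dots> \<le> hausdorff_measure s (A \<union> B)"
  proof (rule SUP_least)
    fix \<delta> :: ennreal assume "\<delta> \<in> {0<..}"
    define d where "d = min \<delta> (ennreal (\<eta>/2))"
    have d: "0 < d" "d \<le> \<delta>" "d < ennreal \<eta>"
      using \<open>\<delta> \<in> _\<close> assms(1) by (auto simp: d_def min_less_iff_disj ennreal_less_iff)
    have "hausdorff_content s \<delta> A + hausdorff_content s \<delta> B \<le> hausdorff_content s d A + hausdorff_content s d B"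
      using d by (intro add_mono hausdorff_content_antimono)
    also have "\<dots> \<le> hausdorff_content s d (A \<union> B)"
      using d assms by (intro hausdorff_content_add_separated) auto
    also have "\<dots> \<le> hausdorff_measure s (A \<union> B)"
      using d by (intro hausdorff_content_le_measure)
    finally show "hausdorff_content s \<delta> A + hausdorff_content s \<delta> B \<le> hausdorff_measure s (A \<union> B)" .
  qed
  finally show ?thesis .
qed

lemma sum_hausdorff_measure_separated:
  assumes "\<eta> > 0" "finite I"
    and "\<And>i j x y. i \<in> I \<Longrightarrow> j \<in> I \<Longrightarrow> i \<noteq> j \<Longrightarrow> x \<in> A i \<Longrightarrow> y \<in> A j \<Longrightarrow> \<eta> \<le> dist x y"
  shows "(\<Sum>i\<in>I. hausdorff_measure s (A i)) \<le> hausdorff_measure s (\<Union>i\<in>I. A i)"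
  using assms(2,3)
proof (induction I rule: finite_induct)
  case (insert i I)
  have "hausdorff_measure s (A i) + (\<Sum>i\<in>I. hausdorff_measure s (A i)) \<le>
      hausdorff_measure s (A i) + hausdorff_measure s (\<Union>i\<in>I. A i)"
    using insert by (intro add_left_mono insert.IH) blast
  also have "\<dots> \<le> hausdorff_measure s (A i \<union> (\<Union>i\<in>I. A i))"
    using insert assms(1) by (intro hausdorff_measure_add_separated[of \<eta>]) blast+
  finally show ?case using insert by simp
qed simp

section \<open>Expanding maps and change of exponent\<close>

text \<open>Preimages under \<open>f\<close> turn a cover of the image at scale \<open>c * b\<close>
  into a cover of \<open>A\<close> at scale \<open>b\<close>, and each term shrinks by the factor
  \<open>c powr s\<close>.\<close>

lemma hausdorff_measure_expanding_le:
  assumes "s \<ge> 0" "c > 0" "\<And>x y. x \<in> A \<Longrightarrow> y \<in> A \<Longrightarrow> c * dist x y \<le> dist (f x) (f y)"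
  shows "ennreal (c powr s) * hausdorff_measure s A \<le> hausdorff_measure s (f ` A)"
  unfolding hausdorff_measure_def[of s A] SUP_mult_left_ennreal
proof (rule SUP_least)
  fix \<delta> :: ennreal assume "\<delta> \<in> {0<..}"
  then obtain b where b: "b > 0" "ennreal b \<le> \<delta>"
    by (cases \<delta> rule: ennreal_cases) (auto intro: that[of 1])
  have "ennreal (c powr s) * hausdorff_content s \<delta> A \<le>
      hausdorff_content s (ennreal (c * b)) (f ` A)"
  proof (rule hausdorff_content_greatest)
    fix U :: "nat \<Rightarrow> 'b set"
    assume U: "f ` A \<subseteq> (\<Union>i. U i)" "\<And>i. ediameter (U i) \<le> ennreal (c * b)"
    define W where "W i = {x \<in> A. f x \<in> U i}" for i
    have "ennreal (dist x y) \<le> \<delta>" if "x \<in> W i" "y \<in> W i" for x y i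
    proof -
      have "dist (f x) (f y) \<le> c * b"
        using U(2)[of i] that b assms(2) by (auto simp: ediameter_le_iff W_def)
      then have "c * dist x y \<le> c * b"
        using assms(3)[of x y] that by (auto simp: W_def)
      then show ?thesis
        using assms(2) b(2) by (auto intro: order_trans[OF ennreal_leI])
    qed
    then have "hausdorff_content s \<delta> A \<le> (\<Sum>i. diam_power s (W i))"
      using U(1) by (intro hausdorff_content_le_suminf) (auto simp: W_def ediameter_le_iff)
    then have "ennreal (c powr s) * hausdorff_content s \<delta> A
        \<le> (\<Sum>i. ennreal (c powr s) * diam_power s (W i))"
      by (simp add: mult_left_mono)
    also have "\<dots> \<le> (\<Sum>i. diam_power s (U i))"
      using assms by (intro suminf_le diam_power_expanding_le) (auto simp: W_def)
    finally show "ennreal (c powr s) * hausdorff_content s \<delta> A \<le> (\<Sum>i. diam_power s (U i))" .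
  qed
  also have "\<dots> \<le> hausdorff_measure s (f ` A)"
    using b assms by (intro hausdorff_content_le_measure) auto
  finally show "ennreal (c powr s) * hausdorff_content s \<delta> A \<le> hausdorff_measure s (f ` A)" .
qed

lemma diam_power_antimono_exponent:
  assumes "0 \<le> s" "s \<le> t" "ediameter U \<le> 1"
  shows "diam_power t U \<le> diam_power s U"
proof -
  have "bounded U" "diameter U \<le> 1"
    using assms(3) by (auto simp: ediameter_def top_unique split: if_splits)
  \<comment> \<open>The second instance of \<open>powr_mono'\<close> is for \<open>s = 0\<close>,
    where \<open>diam_power\<close> is \<open>1\<close> by convention.\<close>
  then show ?thesis
    using assms powr_mono'[of s t "diameter U"] powr_mono'[of 0 t "diameter U"]
    by (auto simp: diam_power_def diameter_ge_0 intro!: ennreal_leI split: if_splits)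
qed

lemma hausdorff_measure_antimono_exponent:
  assumes "0 \<le> s" "s \<le> t"
  shows "hausdorff_measure t A \<le> hausdorff_measure s A"
proof (rule hausdorff_measure_le_contentI[of 1])
  fix b :: real assume b: "0 < b" "b \<le> 1"
  have "hausdorff_content t (ennreal b) A \<le> hausdorff_content s (ennreal b) A"
  proof (rule hausdorff_content_greatest)
    fix U :: "nat \<Rightarrow> 'a set"
    assume U: "A \<subseteq> (\<Union>i. U i)" "\<And>i. ediameter (U i) \<le> ennreal b"
    have "ennreal b \<le> 1" using b by simp
    then have "ediameter (U i) \<le> 1" for i
      using U(2) order_trans by blast
    then have "(\<Sum>i. diam_power t (U i)) \<le> (\<Sum>i. diam_power s (U i))"
      using assms by (intro suminf_le diam_power_antimono_exponent) auto
    then show "hausdorff_content t (ennreal b) A \<le> (\<Sum>i. diam_power s (U i))"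
      using hausdorff_content_le_suminf[OF U] order_trans by blast
  qed
  also have "\<dots> \<le> hausdorff_measure s A"
    using b by (intro hausdorff_content_le_measure) simp
  finally show "hausdorff_content t (ennreal b) A \<le> hausdorff_measure s A" .
qed simp

section \<open>Packings and Hausdorff dimension\<close>

text \<open>The balls of radius \<open>R/2\<close> around the points are disjoint and lie in the
  ball of radius \<open>K + R/2\<close>; volumes are compared.\<close>

lemma card_separated_le:
  fixes X :: "'a::euclidean_space set"
  assumes "finite X" "X \<subseteq> cball 0 K" "R > 0" "K \<ge> 0"
    and sep: "\<And>x y. x \<in> X \<Longrightarrow> y \<in> X \<Longrightarrow> x \<noteq> y \<Longrightarrow> R \<le> dist x y"
  shows "real (card X) \<le> ((2 * K + R) / R) ^ DIM('a)"
proof -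
  define v where "v = unit_ball_vol (real DIM('a))"
  have v: "v > 0" by (simp add: v_def unit_ball_vol_pos)
  have "disjoint_family_on (\<lambda>x. ball x (R/2)) X"
  proof (unfold disjoint_family_on_def, safe)
    fix x y z assume xy: "x \<in> X" "y \<in> X" "x \<noteq> y" "z \<in> ball x (R/2)" "z \<in> ball y (R/2)"
    then show "z \<in> {}"
      using sep[OF xy(1-3)] dist_triangle[of x y z] by (simp add: dist_commute)
  qed
  then have "measure lborel (\<Union>x\<in>X. ball x (R/2)) = (\<Sum>x\<in>X. measure lborel (ball x (R/2)))"
    using assms(1) emeasure_lborel_ball_finite
    by (intro measure_finite_Union) (auto simp: less_top)
  also have "\<dots> = real (card X) * (v * (R/2) ^ DIM('a))"
    using assms(3) by (simp add: content_ball v_def)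
  finally have "real (card X) * (v * (R/2) ^ DIM('a)) = measure lborel (\<Union>x\<in>X. ball x (R/2))" ..
  also have "\<dots> \<le> measure lborel (cball (0::'a) (K + R/2))"
  proof (rule measure_mono_fmeasurable)
    show "(\<Union>x\<in>X. ball x (R/2)) \<subseteq> cball 0 (K + R/2)"
    proof
      fix z assume "z \<in> (\<Union>x\<in>X. ball x (R/2))"
      then obtain x where "x \<in> X" "dist x z < R/2" by auto
      moreover from this have "dist 0 x \<le> K" using assms(2) by auto
      ultimately show "z \<in> cball 0 (K + R/2)"
        using dist_triangle[of 0 z x] by simp
    qed
    show "(\<Union>x\<in>X. ball x (R/2)) \<in> sets lborel"
      using assms(1) by (intro sets.finite_UN) auto
    show "cball (0::'a) (K + R/2) \<in> fmeasurable lborel"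
      using emeasure_lborel_cball_finite by (intro fmeasurableI) auto
  qed
  also have "\<dots> = v * (K + R/2) ^ DIM('a)"
    using assms by (simp add: content_cball v_def)
  finally have "real (card X) * (R/2) ^ DIM('a) \<le> (K + R/2) ^ DIM('a)"
    using v by (simp only: mult.left_commute[of "real (card X)"] mult_le_cancel_left_pos)
  then have "real (card X) \<le> ((K + R/2) / (R/2)) ^ DIM('a)"
    using assms(3) by (simp only: power_divide[of "K + R/2"] pos_le_divide_eq zero_less_power half_gt_zero)
  also have "(K + R/2) / (R/2) = (2 * K + R) / R"
    using assms(3) by (simp add: field_simps)
  finally show ?thesis .
qed

text \<open>The volume bound permits a separated set of greatest cardinality; a point left uncovered
  could be added to it.\<close>

lemma maximal_separated_set:
  fixes F :: "'a::euclidean_space set"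
  assumes "bounded F" "R > 0"
  obtains X where "finite X" "X \<subseteq> F" "\<forall>x\<in>X. \<forall>y\<in>X. x \<noteq> y \<longrightarrow> R \<le> dist x y"
    "F \<subseteq> (\<Union>x\<in>X. cball x R)"
proof -
  obtain K where K: "F \<subseteq> cball 0 K" "K > 0"
    using bounded_subset_ballD[OF assms(1), of 0] ball_subset_cball order_trans by blast
  define \<X> where "\<X> = {X. finite X \<and> X \<subseteq> F \<and> (\<forall>x\<in>X. \<forall>y\<in>X. x \<noteq> y \<longrightarrow> R \<le> dist x y)}"
  have bd: "card X \<le> nat \<lceil>((2 * K + R) / R) ^ DIM('a)\<rceil>" if "X \<in> \<X>" for X
  proof -
    have "real (card X) \<le> ((2 * K + R) / R) ^ DIM('a)"
      using that K assms(2) by (intro card_separated_le) (auto simp: \<X>_def)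
    then show ?thesis by linarith
  qed
  have "{} \<in> \<X>" by (simp add: \<X>_def)
  then obtain X where X: "X \<in> \<X>" "\<And>Y. Y \<in> \<X> \<Longrightarrow> card Y \<le> card X"
    using ex_has_greatest_nat[of "\<lambda>X. X \<in> \<X>" "{}" card
        "Suc (nat \<lceil>((2 * K + R) / R) ^ DIM('a)\<rceil>)"] bd
    by (metis less_Suc_eq_le)
  have "F \<subseteq> (\<Union>x\<in>X. cball x R)"
  proof (rule ccontr)
    assume "\<not> ?thesis"
    then obtain y where y: "y \<in> F" "\<And>x. x \<in> X \<Longrightarrow> R < dist x y" by (force simp: not_le)
    then have "y \<notin> X" using assms(2) by force
    have "insert y X \<in> \<X>"
      using X(1) y by (auto simp: \<X>_def dist_commute intro: less_imp_le)
    then show False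
      using X(1) X(2)[of "insert y X"] \<open>y \<notin> X\<close> by (auto simp: \<X>_def)
  qed
  then show ?thesis
    using X(1) by (intro that[of X]) (auto simp: \<X>_def)
qed

lemma dist_le_two_mult_radius:
  fixes x y z :: "'a::metric_space"
  shows "x \<in> cball z R \<Longrightarrow> y \<in> cball z R \<Longrightarrow> dist x y \<le> 2 * R"
  using dist_triangle[of x y z] by (simp add: dist_commute)

lemma hausdorff_content_cball_cover_le:
  assumes "s \<ge> 0" "R > 0" "finite X" "A \<subseteq> (\<Union>x\<in>X. cball x R)"
  shows "hausdorff_content s (ennreal (2 * R)) A \<le> ennreal (real (card X) * (2 * R) powr s)"
  by (rule hausdorff_content_finite_cover_le[OF assms(1) _ assms(3,4) dist_le_two_mult_radius])
    (use assms(2) in auto)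

section \<open>Hausdorff dimension of bounded sets\<close>

text \<open>Of the order of \<open>R ^ (-n)\<close> balls of radius \<open>R\<close> suffice, at a
  total cost of order \<open>R\<close>. This makes the set in \<open>hausdorff_dim\<close> nonempty,
  so that its infimum is meaningful.\<close>

lemma hausdorff_measure_above_DIM_eq_0:
  fixes F :: "'a::euclidean_space set"
  assumes "bounded F"
  shows "hausdorff_measure (real DIM('a) + 1) F = 0"
proof -
  obtain K where K: "F \<subseteq> cball 0 K" "K > 0"
    using bounded_subset_ballD[OF assms, of 0] ball_subset_cball order_trans by blast
  define n where "n = DIM('a)"
  \<comment> \<open>The first factor counts the balls when \<open>R \<le> 1\<close>; the second
    comes from their diameters \<open>2 * R\<close>.\<close>
  define c where "c = (2 * K + 1) ^ n * 2 ^ (n + 1)"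
  have c: "c > 0" using K by (simp add: c_def)
  have le: "hausdorff_content (real n + 1) (ennreal (2 * R)) F \<le> ennreal (c * R)" if R: "0 < R" "R \<le> 1" for R
  proof -
    obtain X where X: "finite X" "X \<subseteq> F" "\<forall>x\<in>X. \<forall>y\<in>X. x \<noteq> y \<longrightarrow> R \<le> dist x y"
      "F \<subseteq> (\<Union>x\<in>X. cball x R)"
      by (rule maximal_separated_set[OF assms \<open>0 < R\<close>]) (rule that)
    have "real (card X) \<le> ((2 * K + R) / R) ^ n"
      unfolding n_def using X K R by (intro card_separated_le) auto
    also have "\<dots> \<le> ((2 * K + 1) / R) ^ n"
      using K R by (intro power_mono divide_right_mono) auto
    finally have "real (card X) * (2 * R) ^ (n + 1) \<le> ((2 * K + 1) / R) ^ n * (2 * R) ^ (n + 1)"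
      using R by (intro mult_right_mono) auto
    also have "\<dots> = c * R"
      using R by (simp add: c_def power_divide power_mult_distrib)
    finally have card_le: "real (card X) * (2 * R) powr (real n + 1) \<le> c * R"
      using R powr_realpow[of "2 * R" "n + 1"] by (simp add: add.commute)
    have "hausdorff_content (real n + 1) (ennreal (2 * R)) F
        \<le> ennreal (real (card X) * (2 * R) powr (real n + 1))"
      using X R by (intro hausdorff_content_cball_cover_le) auto
    also have "\<dots> \<le> ennreal (c * R)"
      by (rule ennreal_leI[OF card_le])
    finally show ?thesis .
  qed
  have small: "hausdorff_measure (real n + 1) F \<le> 0 + ennreal e" if "e > 0" for e
  proof (rule hausdorff_measure_le_contentI[of "min 2 (2 * e / c)"])
    fix b assume b: "0 < b" "b \<le> min 2 (2 * e / c)"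
    then have "c * (b / 2) \<le> e" using c by (simp add: field_simps)
    then show "hausdorff_content (real n + 1) (ennreal b) F \<le> 0 + ennreal e"
      using order_trans[OF le[of "b / 2"] ennreal_leI, of e] b by simp
  qed (use that c in auto)
  have "hausdorff_measure (real n + 1) F \<le> 0"
    by (rule ennreal_le_epsilon) (rule small)
  then show ?thesis by (simp add: n_def)
qed

lemma hausdorff_dim_nonneg:
  fixes F :: "'a::euclidean_space set"
  assumes "bounded F"
  shows "0 \<le> hausdorff_dim F"
  unfolding hausdorff_dim_def
  by (rule cInf_greatest) (use hausdorff_measure_above_DIM_eq_0[OF assms] in \<open>auto intro!: exI[of _ "real DIM('a) + 1"]\<close>)

lemma hausdorff_measure_above_dim_eq_0:
  fixes F :: "'a::euclidean_space set"
  assumes "bounded F" "hausdorff_dim F < t"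
  shows "hausdorff_measure t F = 0"
proof -
  have "{s. 0 \<le> s \<and> hausdorff_measure s F = 0} \<noteq> {}"
    using hausdorff_measure_above_DIM_eq_0[OF assms(1)]
    by (auto intro!: exI[of _ "real DIM('a) + 1"])
  from cInf_lessD[OF this assms(2)[unfolded hausdorff_dim_def]]
  obtain s where "0 \<le> s" "hausdorff_measure s F = 0" "s < t"
    by blast
  then show ?thesis
    using hausdorff_measure_antimono_exponent[of s t F] by simp
qed

section \<open>Lower bounds for the content from separated copies\<close>

text \<open>
  A mass distribution principle without measures. If all covering sets have diameter less than
  \<open>\<delta>\<close>, each meets at most one of the copies of \<open>F\<close>; pulling back the sets that meet a given copy
  yields a cover of \<open>F\<close> by fewer sets, so induction on the number of sets applies.
\<close>
lemma finite_cover_diam_power_sum_ge: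
  fixes F :: "'a::metric_space set" and g :: "'i \<Rightarrow> 'a \<Rightarrow> 'a" and U :: "'j \<Rightarrow> 'a set"
  assumes "F \<noteq> {}" "\<rho> > 0" "\<delta> > 0" "t \<ge> 0"
    and I: "finite I" "card I \<ge> 2" "real (card I) * \<rho> powr t \<ge> 1"
    and gF: "\<And>i. i \<in> I \<Longrightarrow> g i ` F \<subseteq> F"
    and expand: "\<And>i y z. i \<in> I \<Longrightarrow> y \<in> F \<Longrightarrow> z \<in> F \<Longrightarrow> \<rho> * dist y z \<le> dist (g i y) (g i z)"
    and sep: "\<And>i j y z. i \<in> I \<Longrightarrow> j \<in> I \<Longrightarrow> i \<noteq> j \<Longrightarrow> y \<in> F \<Longrightarrow> z \<in> F \<Longrightarrow> \<delta> \<le> dist (g i y) (g j z)"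
    and "finite J" "F \<subseteq> (\<Union>j\<in>J. U j)"
  shows "ennreal (\<delta> powr t) \<le> (\<Sum>j\<in>J. diam_power t (U j))"
  using \<open>finite J\<close> \<open>F \<subseteq> (\<Union>j\<in>J. U j)\<close>
proof (induction "card J" arbitrary: J U rule: less_induct)
  case less
  show ?case
  proof (rule ccontr)
    assume "\<not> ?case"
    then have small: "(\<Sum>j\<in>J. diam_power t (U j)) < ennreal (\<delta> powr t)" by simp
    define P where "P i = {j \<in> J. U j \<inter> g i ` F \<noteq> {}}" for i
    have disj: "P i \<inter> P k = {}" if ik: "i \<in> I" "k \<in> I" "i \<noteq> k" for i k
    proof (rule ccontr)
      assume "P i \<inter> P k \<noteq> {}"
      then obtain j y z where j: "j \<in> J" "y \<in> F" "z \<in> F" "g i y \<in> U j" "g k z \<in> U j"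
        unfolding P_def by blast
      have "ennreal (\<delta> powr t) \<le> diam_power t (U j)"
        using j sep[OF ik] assms(3,4) by (intro powr_dist_le_diam_power[of t \<delta> "g i y" _ "g k z"]) auto
      also have "\<dots> \<le> (\<Sum>j\<in>J. diam_power t (U j))"
        using j less.prems(1) by (intro member_le_sum) auto
      finally show False using small by simp
    qed
    have ne: "P i \<noteq> {}" if "i \<in> I" for i
    proof -
      obtain y where "y \<in> F" using assms(1) by blast
      then have "g i y \<in> (\<Union>j\<in>J. U j)" using gF[OF that] less.prems(2) by blast
      then show ?thesis using \<open>y \<in> F\<close> by (auto simp: P_def)
    qed
    have piece: "ennreal (\<rho> powr t) * ennreal (\<delta> powr t) \<le> (\<Sum>j\<in>P i. diam_power t (U j))" if i: "i \<in> I" for i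
    proof -
      have "\<exists>k\<in>I. k \<noteq> i"
      proof (rule ccontr)
        assume "\<not> ?thesis"
        then have "I \<subseteq> {i}" by blast
        then have "card I \<le> 1" using card_mono[of "{i}" I] by simp
        then show False using I(2) by simp
      qed
      then obtain k where k: "k \<in> I" "k \<noteq> i" by blast
      \<comment> \<open>A second copy \<open>k\<close> needs covering sets of its own, so strictly
        fewer sets meet copy \<open>i\<close>. This is where \<open>card I \<ge> 2\<close>
        enters.\<close>
      have "P i \<subset> J"
        using disj[OF k(1) i k(2)] ne[OF k(1)] unfolding P_def by blast
      then have less': "card (P i) < card J" "finite (P i)"
        using less.prems(1) by (auto intro: psubset_card_mono finite_subset)
      define V where "V j = {y \<in> F. g i y \<in> U j}" for j
      have cover: "F \<subseteq> (\<Union>j\<in>P i. V j)"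
      proof
        fix y assume "y \<in> F"
        then have "g i y \<in> (\<Union>j\<in>J. U j)" using gF[OF i] less.prems(2) by blast
        then show "y \<in> (\<Union>j\<in>P i. V j)" using \<open>y \<in> F\<close> by (auto simp: P_def V_def)
      qed
      have "ennreal (\<rho> powr t) * ennreal (\<delta> powr t) \<le> ennreal (\<rho> powr t) * (\<Sum>j\<in>P i. diam_power t (V j))"
        using less.hyps[OF less'(1,2) cover] by (intro mult_left_mono) auto
      also have "\<dots> = (\<Sum>j\<in>P i. ennreal (\<rho> powr t) * diam_power t (V j))"
        by (rule sum_distrib_left)
      also have "\<dots> \<le> (\<Sum>j\<in>P i. diam_power t (U j))"
        using assms(2,4) expand[OF i]
        by (intro sum_mono diam_power_expanding_le[where f = "g i"]) (auto simp: V_def)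
      finally show ?thesis .
    qed
    \<comment> \<open>Each copy costs at least \<open>\<rho> powr t * \<delta> powr t\<close>, and
      \<open>card I * \<rho> powr t \<ge> 1\<close> restores the full bound.\<close>
    have "ennreal (\<delta> powr t) \<le> ennreal (real (card I) * \<rho> powr t * \<delta> powr t)"
      using I(3) by (intro ennreal_leI) (simp add: mult_le_cancel_right1)
    also have "\<dots> = (\<Sum>i\<in>I. ennreal (\<rho> powr t) * ennreal (\<delta> powr t))"
      by (simp add: ennreal_mult ennreal_of_nat_eq_real_of_nat mult.assoc)
    also have "\<dots> \<le> (\<Sum>i\<in>I. \<Sum>j\<in>P i. diam_power t (U j))"
      by (intro sum_mono piece)
    also have "\<dots> = (\<Sum>j\<in>(\<Union>i\<in>I. P i). diam_power t (U j))"
      using I(1) less.prems(1) disj by (intro sum.UNION_disjoint[symmetric]) (auto simp: P_def)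
    also have "\<dots> \<le> (\<Sum>j\<in>J. diam_power t (U j))"
      using less.prems(1) by (intro sum_mono2) (auto simp: P_def)
    finally show False using small by simp
  qed
qed

text \<open>Enlarging the sets to open ones at total cost \<open>e\<close> lets compactness extract
  a finite subcover.\<close>

lemma hausdorff_content_ge_finite_covers:
  fixes F :: "'a::metric_space set"
  assumes "compact F" "t > 0"
    and finite_ge: "\<And>(J::nat set) U. finite J \<Longrightarrow> F \<subseteq> (\<Union>j\<in>J. U j) \<Longrightarrow> c \<le> (\<Sum>j\<in>J. diam_power t (U j))"
  shows "c \<le> hausdorff_content t \<infinity> F"
proof (rule hausdorff_content_greatest)
  fix U :: "nat \<Rightarrow> 'a set"
  assume U: "F \<subseteq> (\<Union>i. U i)"
  show "c \<le> (\<Sum>i. diam_power t (U i))"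
  proof (rule ennreal_le_epsilon)
    fix e :: real assume "e > 0"
    then have "\<exists>V. open V \<and> U n \<subseteq> V \<and> diam_power t V \<le> diam_power t (U n) + ennreal (e * (1/2) ^ Suc n)" for n
      using diam_power_enlarge_open[of t "e * (1/2) ^ Suc n" "U n"] assms(2)
      by (metis divide_pos_pos mult_pos_pos zero_less_numeral zero_less_one zero_less_power)
    then obtain V where V: "\<And>n. open (V n)" "\<And>n. U n \<subseteq> V n"
      "\<And>n. diam_power t (V n) \<le> diam_power t (U n) + ennreal (e * (1/2) ^ Suc n)"
      by metis
    have "F \<subseteq> (\<Union>n\<in>UNIV. V n)" by (rule order_trans[OF U]) (use V(2) in blast)
    then obtain J where J: "finite J" "F \<subseteq> (\<Union>j\<in>J. V j)"
      using compactE_image[OF assms(1), of UNIV V] V(1) by auto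
    have "c \<le> (\<Sum>j\<in>J. diam_power t (V j))" by (rule finite_ge[OF J])
    also have "\<dots> \<le> (\<Sum>n. diam_power t (V n))" using J by (intro sum_le_suminf) auto
    also have "\<dots> \<le> (\<Sum>n. diam_power t (U n) + ennreal (e * (1/2) ^ Suc n))"
      using V(3) by (intro suminf_le) auto
    also have "\<dots> = (\<Sum>n. diam_power t (U n)) + (\<Sum>n. ennreal (e * (1/2) ^ Suc n))"
      by (simp add: suminf_add)
    also have "(\<Sum>n. ennreal (e * (1/2) ^ Suc n)) = ennreal e"
      using \<open>e > 0\<close> by (rule suminf_ennreal_half_powers)
    finally show "c \<le> (\<Sum>i. diam_power t (U i)) + ennreal e" .
  qed
qed

section \<open>Quasi self-similar sets\<close>

text \<open>The threshold \<open>r0\<close> stands in for the diameter of \<open>F\<close> and is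
  positive even if \<open>F\<close> is a singleton.\<close>

locale quasi_self_similar =
  fixes F :: "'a::euclidean_space set" and s D r0 :: real
  assumes compact: "compact F" and nonempty: "F \<noteq> {}" and s: "s = hausdorff_dim F" and D: "D \<ge> 1" and r0: "r0 > 0"
    and maps: "\<And>x r. x \<in> F \<Longrightarrow> 0 < r \<Longrightarrow> r \<le> r0 \<Longrightarrow>
      \<exists>g. g \<in> F \<rightarrow> F \<inter> cball x r \<and>
        (\<forall>y\<in>F. \<forall>z\<in>F. r / D * dist y z \<le> dist (g y) (g z) \<and> dist (g y) (g z) \<le> D * r * dist y z)"
begin

lemma bounded: "bounded F"
  using compact by (rule compact_imp_bounded)

lemma s_nonneg: "s \<ge> 0"
  unfolding s using bounded by (rule hausdorff_dim_nonneg)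

text \<open>Fixing one map per centre and radius lets copies of \<open>F\<close> be indexed by the
  points of a packing.\<close>

definition copy :: "real \<Rightarrow> 'a \<Rightarrow> 'a \<Rightarrow> 'a" where
  "copy r x = (SOME g. g \<in> F \<rightarrow> F \<inter> cball x r \<and>
     (\<forall>y\<in>F. \<forall>z\<in>F. r / D * dist y z \<le> dist (g y) (g z) \<and> dist (g y) (g z) \<le> D * r * dist y z))"

lemma copy:
  assumes "x \<in> F" "0 < r" "r \<le> r0" "y \<in> F"
  shows copy_in: "copy r x y \<in> F" and dist_copy: "dist x (copy r x y) \<le> r"
    and copy_expanding: "z \<in> F \<Longrightarrow> r / D * dist y z \<le> dist (copy r x y) (copy r x z)"
    and copy_lipschitz: "z \<in> F \<Longrightarrow> dist (copy r x y) (copy r x z) \<le> D * r * dist y z"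
  using someI_ex[OF maps[OF assms(1-3)], folded copy_def] assms(4) by auto

lemma copies_separated:
  assumes "x \<in> F" "x' \<in> F" "0 < r" "r \<le> r0" "y \<in> F" "z \<in> F" "3 * r \<le> dist x x'"
  shows "r \<le> dist (copy r x y) (copy r x' z)"
proof -
  have "dist x (copy r x y) \<le> r" "dist x' (copy r x' z) \<le> r"
    using assms by (auto intro: dist_copy)
  moreover have "dist x x' \<le> dist x (copy r x y) + dist (copy r x y) (copy r x' z) + dist x' (copy r x' z)"
    by metric
  ultimately show ?thesis using assms(7) by linarith
qed

section \<open>Finiteness of the measure\<close>

text \<open>If the bound failed, the exponent \<open>t\<close> with
  \<open>card X * (r / D) powr t = 1\<close> would exceed \<open>s\<close>, and yet the
  \<open>t\<close>-dimensional content of \<open>F\<close> would be at least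
  \<open>r powr t\<close>.\<close>

lemma card_separated_le_powr_dim:
  assumes "finite X" "X \<subseteq> F" "0 < r" "r \<le> r0" "r < D"
    and sep: "\<forall>x\<in>X. \<forall>y\<in>X. x \<noteq> y \<longrightarrow> 3 * r \<le> dist x y"
  shows "real (card X) \<le> (D / r) powr s"
proof (rule ccontr)
  assume "\<not> ?thesis"
  then have less: "(D / r) powr s < real (card X)" by simp
  have Dr: "D / r > 1" using assms by simp
  \<comment> \<open>The base exceeds \<open>1\<close> by \<open>r < D\<close>; hence there are at
    least two copies, and exponents can be compared through powers.\<close>
  have "1 \<le> (D / r) powr s" using Dr s_nonneg by (simp add: ge_one_powr_ge_zero)
  then have card: "card X \<ge> 2" using less by linarith
  define t where "t = log (D / r) (real (card X))"
  have t: "(D / r) powr t = real (card X)"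
    unfolding t_def using Dr card by (intro powr_log_cancel) auto
  then have "s < t"
    using less powr_less_cancel_iff[OF Dr] by metis
  then have "t > 0" using s_nonneg by simp
  have "real (card X) * (r / D) powr t = ((D / r) * (r / D)) powr t"
    using assms(3) D by (subst powr_mult) (auto simp: t)
  then have inv: "real (card X) * (r / D) powr t \<ge> 1"
    using assms(3) D by simp
  have "ennreal (r powr t) \<le> (\<Sum>j\<in>J. diam_power t (U j))"
    if "finite J" "F \<subseteq> (\<Union>j\<in>J. U j)" for J :: "nat set" and U
  proof (rule finite_cover_diam_power_sum_ge[where g = "copy r" and F = F and \<rho> = "r / D" and I = X])
    show "r \<le> dist (copy r x y) (copy r x' z)"
      if "x \<in> X" "x' \<in> X" "x \<noteq> x'" "y \<in> F" "z \<in> F" for x x' y z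
      using that assms by (intro copies_separated) auto
    show "r / D * dist y z \<le> dist (copy r x y) (copy r x z)" if "x \<in> X" "y \<in> F" "z \<in> F" for x y z
      using that assms by (intro copy_expanding) auto
    show "copy r x ` F \<subseteq> F" if "x \<in> X" for x
      using that assms by (auto intro: copy_in)
  qed (use that assms nonempty D card inv \<open>t > 0\<close> in auto)
  then have "ennreal (r powr t) \<le> hausdorff_content t \<infinity> F"
    by (intro hausdorff_content_ge_finite_covers compact \<open>t > 0\<close>)
  also have "\<dots> \<le> hausdorff_measure t F"
    by (intro hausdorff_content_le_measure) simp
  also have "\<dots> = 0"
    using bounded \<open>s < t\<close>[unfolded s] by (rule hausdorff_measure_above_dim_eq_0)
  finally show False using assms(3) by simp
qed

text \<open>At most \<open>(D / r) powr s\<close> sets of diameter at most \<open>6 * r\<close>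
  cover \<open>F\<close>, and the powers of \<open>r\<close> cancel.\<close>

lemma hausdorff_measure_le: "hausdorff_measure s F \<le> ennreal ((6 * D) powr s)"
proof (rule hausdorff_measure_le_contentI)
  show "0 < 6 * min r0 (D / 2)" using r0 D by simp
  fix b assume b: "0 < b" "b \<le> 6 * min r0 (D / 2)"
  define r where "r = b / 6"
  have r: "0 < r" "r \<le> r0" "r < D" "b = 6 * r"
    using b D by (auto simp: r_def)
  have "3 * r > 0" using r by simp
  obtain X where X: "finite X" "X \<subseteq> F" "\<forall>x\<in>X. \<forall>y\<in>X. x \<noteq> y \<longrightarrow> 3 * r \<le> dist x y"
      "F \<subseteq> (\<Union>x\<in>X. cball x (3 * r))"
    by (rule maximal_separated_set[OF bounded \<open>3 * r > 0\<close>]) (rule that)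
  have "hausdorff_content s (ennreal b) F \<le> ennreal (real (card X) * b powr s)"
    using hausdorff_content_cball_cover_le[OF s_nonneg \<open>3 * r > 0\<close> X(1,4)] r(4) by simp
  also have "real (card X) * b powr s \<le> (D / r) powr s * b powr s"
    using card_separated_le_powr_dim[OF X(1,2) r(1-3) X(3)] by (intro mult_right_mono) auto
  also have "(D / r) powr s * b powr s = (6 * D) powr s"
    using r D by (simp flip: powr_mult add: field_simps)
  finally show "hausdorff_content s (ennreal b) F \<le> ennreal ((6 * D) powr s)"
    by (simp add: ennreal_leI)
qed

text \<open>With \<open>c = M r\<^sup>s\<close>, a copy of scale \<open>R\<close> of a set of measure \<open>c\<close> has measure at least
  \<open>(R/D)\<^sup>s c = (4DRr)\<^sup>s + (Rr)\<^sup>s\<close>, where \<open>4DRr\<close> bounds the diameter of a neighbourhood of the copy.\<close>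
definition M :: real where "M = D powr s * ((4 * D) powr s + 1)"

lemma M_ge_1: "M \<ge> 1"
proof -
  have "D powr s \<ge> 1" using D s_nonneg by (simp add: ge_one_powr_ge_zero)
  then show ?thesis
    unfolding M_def using mult_mono[of 1 "D powr s" 1 "(4 * D) powr s + 1"] by simp
qed

section \<open>Upper regularity\<close>

lemma hausdorff_measure_cball_le:
  assumes "r > 0"
  shows "hausdorff_measure s (F \<inter> cball x r) \<le> ennreal (M * r powr s)"
proof (rule ccontr)
  define U where "U = F \<inter> cball x r"
  assume "\<not> ?thesis"
  then have big: "ennreal (M * r powr s) < hausdorff_measure s U" by (simp add: U_def not_le)
  have UF: "U \<subseteq> F" by (simp add: U_def)
  define h where "h = enn2real (hausdorff_measure s F)"
  have fin: "hausdorff_measure s F < top"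
    using hausdorff_measure_le le_less_trans ennreal_less_top by blast
  have h: "hausdorff_measure s F = ennreal h" "h \<ge> 0"
    using fin by (simp_all add: h_def)
  have finite_sub: "hausdorff_measure s A = ennreal (enn2real (hausdorff_measure s A))" if "A \<subseteq> F" for A
    using le_less_trans[OF hausdorff_measure_mono[OF that] fin] by simp
  define u where "u = enn2real (hausdorff_measure s U)"
  have u: "hausdorff_measure s U = ennreal u" "u \<ge> 0"
    using finite_sub[OF UF] by (simp_all add: u_def)
  have Mu: "M * r powr s < u"
    using big M_ge_1 u by (simp add: ennreal_less_iff)
  have "u \<le> h" using hausdorff_measure_mono[OF UF, of s] u h by simp
  moreover have "0 < u"
    using Mu M_ge_1 by (smt (verit) mult_nonneg_nonneg powr_ge_zero)
  ultimately have "h > 0" by simp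
  \<comment> \<open>The saving independent of \<open>R\<close>: below,
    \<open>N * (6 * R) powr s > h / 2\<close>, and the factor \<open>(r / 6) powr s\<close> turns
    the left side into \<open>N * (R * r) powr s\<close>.\<close>
  define \<kappa> where "\<kappa> = h / 2 * (r / 6) powr s"
  have \<kappa>: "\<kappa> > 0" using \<open>h > 0\<close> assms by (simp add: \<kappa>_def)
  have "ennreal (h / 2) < hausdorff_measure s F"
    using h \<open>h > 0\<close> by (simp add: ennreal_less_iff)
  \<comment> \<open>At scales up to \<open>\<delta>\<close> every cover of \<open>F\<close> costs
    more than \<open>h / 2\<close>, which forces the packing to have many points.\<close>
  then obtain \<delta> where \<delta>: "\<delta> > 0" "ennreal (h / 2) < hausdorff_content s \<delta> F"
    unfolding hausdorff_measure_def less_SUP_iff by auto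
  obtain b1 where b1: "b1 > 0" "ennreal b1 \<le> \<delta>"
    using \<delta>(1) by (cases \<delta> rule: ennreal_cases) (auto intro: that[of 1])
  have "hausdorff_measure s F \<le> ennreal (h - \<kappa>)"
  proof (rule hausdorff_measure_le_contentI)
    \<comment> \<open>The bound gives \<open>R \<le> r0\<close>, so that the copies exist, and
      \<open>6 * R \<le> b1\<close>, so that the balls of radius \<open>3 * R\<close> are admissible
      at scale \<open>\<delta>\<close>.\<close>
    show "0 < 4 * D * r * min r0 (b1 / 6)" using D assms r0 b1 by simp
    fix b assume b: "0 < b" "b \<le> 4 * D * r * min r0 (b1 / 6)"
    define R where "R = b / (4 * D * r)"
    have "4 * D * r > 0" using D assms by simp
    have "R \<le> min r0 (b1 / 6)"
      unfolding R_def pos_divide_le_eq[OF \<open>4 * D * r > 0\<close>] using b(2) by (simp only: mult.commute)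
    then have R: "0 < R" "R \<le> min r0 (b1 / 6)" "b = 4 * D * R * r"
      using b \<open>4 * D * r > 0\<close> D assms by (auto simp: R_def)
    have Rr0: "R \<le> r0" and "6 * R \<le> b1" using R(2) by auto
    have "3 * R > 0" using R by simp
    obtain X where X: "finite X" "X \<subseteq> F" "\<forall>x\<in>X. \<forall>y\<in>X. x \<noteq> y \<longrightarrow> 3 * R \<le> dist x y"
        "F \<subseteq> (\<Union>x\<in>X. cball x (3 * R))"
      by (rule maximal_separated_set[OF bounded \<open>3 * R > 0\<close>]) (rule that)
    define N where "N = real (card X)"
    have "ennreal (h / 2) < hausdorff_content s (ennreal (6 * R)) F"
      using \<delta>(2) hausdorff_content_antimono[of "ennreal (6 * R)" \<delta> s F]
        order_trans[OF ennreal_leI[OF \<open>6 * R \<le> b1\<close>] b1(2)] by simp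
    also have "\<dots> \<le> ennreal (N * (6 * R) powr s)"
      using hausdorff_content_cball_cover_le[OF s_nonneg \<open>3 * R > 0\<close> X(1,4)] by (simp add: N_def)
    finally have "h / 2 < N * (6 * R) powr s" using \<open>h > 0\<close> by (simp add: ennreal_less_iff)
    then have "\<kappa> \<le> N * (6 * R) powr s * (r / 6) powr s"
      unfolding \<kappa>_def by (intro mult_right_mono) auto
    also have "\<dots> = N * (R * r) powr s"
      using R assms by (simp add: mult.assoc flip: powr_mult)
    finally have \<kappa>_le: "\<kappa> \<le> N * (R * r) powr s" .

    \<comment> \<open>Removing from \<open>F\<close> not only the copies \<open>G i\<close> but their neighbourhoods makes the remainder
      separated from the copies, so that the measures add up without any measurability theory.\<close>
    define G where "G i = copy R i ` U" for i
    define V where "V = (\<Union>i\<in>X. {y. \<exists>z\<in>G i. dist y z < R * r})"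
    have GF: "G i \<subseteq> F" if "i \<in> X" for i
      using that X(2) UF R(1) Rr0 by (auto simp: G_def intro!: copy_in)
    have G_sep: "R \<le> dist y z" if "i \<in> X" "j \<in> X" "i \<noteq> j" "y \<in> G i" "z \<in> G j" for i j y z
      using that X(2,3) UF R(1) Rr0 by (auto simp: G_def intro!: copies_separated)
    have G_meas: "ennreal ((R / D) powr s * u) \<le> hausdorff_measure s (G i)" if "i \<in> X" for i
    proof -
      have "ennreal ((R / D) powr s) * hausdorff_measure s U \<le> hausdorff_measure s (G i)"
        unfolding G_def
      proof (rule hausdorff_measure_expanding_le[OF s_nonneg])
        show "R / D > 0" using R(1) D by simp
        show "R / D * dist y z \<le> dist (copy R i y) (copy R i z)" if "y \<in> U" "z \<in> U" for y z
          using that \<open>i \<in> X\<close> UF X(2) R(1) Rr0 by (intro copy_expanding) auto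
      qed
      then show ?thesis using u by (simp add: ennreal_mult)
    qed
    define a where "a = enn2real (hausdorff_measure s (F - V))"
    have a: "hausdorff_measure s (F - V) = ennreal a" "a \<ge> 0"
      using finite_sub[of "F - V"] by (auto simp: a_def)
    \<comment> \<open>Remainder and copies are pairwise separated subsets of \<open>F\<close>, so
      their measures add up to at most \<open>h\<close>.\<close>
    have "ennreal (a + N * ((R / D) powr s * u)) = ennreal a + (\<Sum>i\<in>X. ennreal ((R / D) powr s * u))"
      using a u by (simp add: N_def ennreal_mult ennreal_of_nat_eq_real_of_nat)
    also have "\<dots> \<le> hausdorff_measure s (F - V) + (\<Sum>i\<in>X. hausdorff_measure s (G i))"
      using a by (intro add_mono sum_mono G_meas) auto
    also have "\<dots> \<le> hausdorff_measure s (F - V) + hausdorff_measure s (\<Union>i\<in>X. G i)"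
      by (intro add_left_mono sum_hausdorff_measure_separated[OF R(1) X(1)] G_sep)
    also have "\<dots> \<le> hausdorff_measure s ((F - V) \<union> (\<Union>i\<in>X. G i))"
    proof (rule hausdorff_measure_add_separated)
      show "0 < R * r" using R assms by simp
      show "R * r \<le> dist y z" if "y \<in> F - V" "z \<in> (\<Union>i\<in>X. G i)" for y z
        using that by (auto simp: V_def not_less)
    qed
    also have "\<dots> \<le> ennreal h"
      unfolding h(1)[symmetric] using GF by (intro hausdorff_measure_mono) auto
    finally have total: "a + N * ((R / D) powr s * u) \<le> h"
      using h by simp

    have "hausdorff_content s (ennreal b) V \<le> ennreal (N * b powr s)"
      unfolding N_def
    proof (rule hausdorff_content_finite_cover_le[OF s_nonneg b(1) X(1)])
      show "V \<subseteq> (\<Union>i\<in>X. {y. \<exists>z\<in>G i. dist y z < R * r})" by (simp add: V_def)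
      fix i y y' assume i: "i \<in> X" and "y \<in> {y. \<exists>z\<in>G i. dist y z < R * r}"
        "y' \<in> {y. \<exists>z\<in>G i. dist y z < R * r}"
      then obtain z z' where z: "z \<in> U" "z' \<in> U" "dist y (copy R i z) < R * r" "dist y' (copy R i z') < R * r"
        by (auto simp: G_def)
      have "dist z z' \<le> 2 * r"
        using z by (intro dist_le_two_mult_radius[of _ x]) (auto simp: U_def)
      have "dist (copy R i z) (copy R i z') \<le> D * R * dist z z'"
        using i X(2) R(1) Rr0 z UF by (intro copy_lipschitz) auto
      also have "\<dots> \<le> D * R * (2 * r)"
        using D R \<open>dist z z' \<le> 2 * r\<close> by (intro mult_left_mono) auto
      finally have "dist y y' \<le> R * r + D * R * (2 * r) + R * r"
        using z(3,4) dist_triangle[of y y' "copy R i z"] dist_triangle[of "copy R i z" y' "copy R i z'"]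
        by (simp add: dist_commute)
      \<comment> \<open>Since \<open>D \<ge> 1\<close>, \<open>2 * R * r + 2 * D * R * r\<close> is
        at most \<open>4 * D * R * r\<close>.\<close>
      also have "\<dots> \<le> b"
        using mult_right_mono[OF D, of "R * r"] R assms by (simp add: algebra_simps)
      finally show "dist y y' \<le> b" .
    qed
    \<comment> \<open>The remainder is charged its full measure \<open>a\<close>, but the
      neighbourhoods only the cost of one set each.\<close>
    then have "hausdorff_content s (ennreal b) ((F - V) \<union> V) \<le> ennreal a + ennreal (N * b powr s)"
      unfolding a(1)[symmetric] using b(1)
      by (intro order_trans[OF hausdorff_content_Un_le] add_mono hausdorff_content_le_measure) auto
    then have "hausdorff_content s (ennreal b) F \<le> ennreal (a + N * b powr s)"
      using a by (intro order_trans[OF hausdorff_content_mono[of F "(F - V) \<union> V"]])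
        (auto simp: N_def)
    also have "a + N * b powr s \<le> h - \<kappa>"
    proof -
      \<comment> \<open>By the choice of \<open>M\<close>, a copy has measure at least
        \<open>b powr s + (R * r) powr s\<close>, so each covering set saves at least
        \<open>(R * r) powr s\<close>.\<close>
      have "N * b powr s + \<kappa> \<le> N * (b powr s + (R * r) powr s)"
        using \<kappa>_le by (simp add: distrib_left)
      also have "b powr s + (R * r) powr s = (R / D) powr s * (M * r powr s)"
        using R D assms by (simp add: M_def powr_mult powr_divide field_simps)
      also have "N * \<dots> \<le> N * ((R / D) powr s * u)"
        using Mu by (intro mult_left_mono) (auto simp: N_def)
      finally show ?thesis using total by simp
    qed
    finally show "hausdorff_content s (ennreal b) F \<le> ennreal (h - \<kappa>)"
      by (simp add: ennreal_leI)
  qed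
  \<comment> \<open>As \<open>ennreal\<close> truncates negative numbers to \<open>0\<close>, the
    contradiction takes \<open>h > 0\<close> as well as \<open>\<kappa> > 0\<close>.\<close>
  then have "ennreal h \<le> ennreal (h - \<kappa>)" using h by simp
  then show False using \<kappa> \<open>h > 0\<close> by (simp add: ennreal_le_iff2)
qed

section \<open>Comparison of measure and content\<close>

text \<open>A set of positive diameter lies in a ball of that radius about any of its points.
  Diameter \<open>0\<close> gives no admissible radius, but then \<open>U\<close> is a point, which
  is null for \<open>s > 0\<close>.\<close>

lemma hausdorff_measure_le_diam_power:
  "hausdorff_measure s (F \<inter> U) \<le> ennreal M * diam_power s U"
proof (cases "U = {} \<or> s = 0")
  case True
  \<comment> \<open>For \<open>s = 0\<close> the ball bound is \<open>M\<close> at every radius, so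
    one ball around all of \<open>F\<close> suffices.\<close>
  obtain K where "F \<subseteq> ball 0 K" "K > 0" using bounded_subset_ballD[OF bounded, of 0] by metis
  then have "hausdorff_measure s (F \<inter> U) \<le> hausdorff_measure s (F \<inter> cball 0 K)"
    by (intro hausdorff_measure_mono) auto
  also have "\<dots> \<le> ennreal (M * K powr s)"
    using \<open>K > 0\<close> by (rule hausdorff_measure_cball_le)
  finally show ?thesis using True \<open>K > 0\<close> by (cases "U = {}") (simp_all add: diam_power_def)
next
  case False
  then have "s > 0" using s_nonneg by simp
  from False obtain y where y: "y \<in> U" by blast
  consider "\<not> bounded U" | "bounded U" "diameter U > 0" | "bounded U" "diameter U = 0"
    using diameter_ge_0[of U] by linarith
  then show ?thesis
  proof cases
    case 1
    then show ?thesis using False M_ge_1 by (simp add: diam_power_def ennreal_mult_top)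
  next
    case 2
    have "F \<inter> U \<subseteq> F \<inter> cball y (diameter U)"
      using 2 y by (auto intro: diameter_bounded_bound)
    then have "hausdorff_measure s (F \<inter> U) \<le> hausdorff_measure s (F \<inter> cball y (diameter U))"
      by (rule hausdorff_measure_mono)
    also have "\<dots> \<le> ennreal (M * diameter U powr s)"
      using 2 by (intro hausdorff_measure_cball_le)
    finally show ?thesis
      using 2 False M_ge_1 by (simp add: diam_power_def ennreal_mult)
  next
    case 3
    have "z = y" if "z \<in> U" for z
      using diameter_bounded_bound[OF 3(1) that y] 3(2) by simp
    then have "hausdorff_measure s (F \<inter> U) \<le> hausdorff_measure s {y}"
      by (intro hausdorff_measure_mono) blast
    then show ?thesis using hausdorff_measure_singleton[OF \<open>s > 0\<close>, of y] by simp
  qed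
qed

text \<open>The bound for single sets is summed over a cover; dividing by \<open>M\<close> first
  gives a lower bound for the infimum over covers.\<close>

lemma hausdorff_measure_le_content:
  "hausdorff_measure s (F \<inter> A) \<le> ennreal M * hausdorff_content s \<infinity> (F \<inter> A)"
proof -
  have "hausdorff_measure s (F \<inter> A) / ennreal M \<le> hausdorff_content s \<infinity> (F \<inter> A)"
  proof (rule hausdorff_content_greatest)
    fix U :: "nat \<Rightarrow> 'a set"
    assume "F \<inter> A \<subseteq> (\<Union>i. U i)"
    then have "hausdorff_measure s (F \<inter> A) \<le> hausdorff_measure s (\<Union>i. F \<inter> U i)"
      by (intro hausdorff_measure_mono) auto
    also have "\<dots> \<le> (\<Sum>i. hausdorff_measure s (F \<inter> U i))"
      by (rule hausdorff_measure_UN_le)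
    also have "\<dots> \<le> (\<Sum>i. ennreal M * diam_power s (U i))"
      by (intro suminf_le hausdorff_measure_le_diam_power) auto
    also have "\<dots> = (\<Sum>i. diam_power s (U i)) * ennreal M"
      by (simp add: mult.commute)
    finally show "hausdorff_measure s (F \<inter> A) / ennreal M \<le> (\<Sum>i. diam_power s (U i))"
      using M_ge_1 by (simp add: divide_le_posI_ennreal mult.commute)
  qed
  then have "hausdorff_measure s (F \<inter> A) / ennreal M * ennreal M
      \<le> hausdorff_content s \<infinity> (F \<inter> A) * ennreal M"
    by (rule mult_right_mono) simp
  then show ?thesis
    using M_ge_1 by (simp add: ennreal_divide_times) (simp add: mult.commute)
qed

end

theorem theorem2p1:
  fixes F :: "(real ^ 'd) set" and s D :: real
  assumes "compact F" and "F \<noteq> {}"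
    and "s = hausdorff_dim F"
    and "D \<ge> 1"
    and "\<forall>x\<in>F. \<forall>r. 0 < r \<and> r \<le> diameter F \<longrightarrow>
           (\<exists>g. g \<in> F \<rightarrow> F \<inter> cball x r \<and>
             (\<forall>y\<in>F. \<forall>z\<in>F. inverse D * r * norm (y - z) \<le> norm (g y - g z) \<and>
                             norm (g y - g z) \<le> D * r * norm (y - z)))"
  shows "\<exists>C::real. C \<ge> 1 \<and>
           (\<forall>x r. r > 0 \<longrightarrow> hausdorff_measure s (F \<inter> cball x r) \<le> ennreal (C * r powr s)) \<and>
           (\<forall>A. hausdorff_measure s (F \<inter> A) \<le> ennreal C * hausdorff_content s \<infinity> (F \<inter> A))"
proof -
  \<comment> \<open>The hypothesis is void when \<open>F\<close> is a singleton; a constant map then serves for every radius.\<close>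
  define r0 where "r0 = (if diameter F > 0 then diameter F else 1)"
  interpret quasi_self_similar F s D r0
  proof
    fix x r assume x: "x \<in> F" and r: "0 < r" "r \<le> r0"
    show "\<exists>g. g \<in> F \<rightarrow> F \<inter> cball x r \<and>
        (\<forall>y\<in>F. \<forall>z\<in>F. r / D * dist y z \<le> dist (g y) (g z) \<and> dist (g y) (g z) \<le> D * r * dist y z)"
    proof (cases "diameter F > 0")
      case True
      have "r / D = inverse D * r" by (simp add: divide_inverse)
      then show ?thesis
        using assms(5) x r True by (simp add: r0_def dist_norm)
    next
      case False
      have "y = x" if "y \<in> F" for y
        using diameter_bounded_bound[OF compact_imp_bounded[OF assms(1)] that x] False
        by (smt (verit) dist_eq_0_iff zero_le_dist)
      then have "F = {x}" using x by blast
      then show ?thesis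
        using r(1) by (intro exI[of _ "\<lambda>_. x"]) simp
    qed
  qed (use assms in \<open>auto simp: r0_def\<close>)
  show ?thesis
    using M_ge_1 hausdorff_measure_cball_le hausdorff_measure_le_content
    by (intro exI[of _ M]) simp
qed

end
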